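(* Let $\mathcal{T}$ be a TBox, let $\Sigma\subseteq\mathrm{sig}(\mathcal{T})$ be a signature, and let $\chi_{\mathsf i}=\langle\theta^{\mathsf i},\mathcal{A}_0^{\mathsf i},\mathcal{A}_r^{\mathsf i}\rangle$ be the module setting for $\mathcal{T}$ and $\Sigma$ defined in the context. Then $\mathcal{M}^{\chi_{\mathsf i}}\equiv^{\mathsf i}_\Sigma\mathcal{T}$, i.e. the module $\mathcal{M}^{\chi_{\mathsf i}}$ is $\Sigma$-implication inseparable from $\mathcal{T}$: for each $\varphi$ of the form $A(\mathbf{x})\to B(\mathbf{x})$ with $A,B\in\Sigma$, $\mathcal{M}^{\chi_{\mathsf i}}\models\varphi$ if and only if $\mathcal{T}\models\varphi$.
   Context: Rules and TBoxes. Standard first-order logic is used. A signature is a set of predicates; $\mathrm{sig}(F)$ is the signature of a set of formulas $F$; the nullary falsehood predicate $\bot$ is assumed to belong to every signature. A rule is a function-free sentence $\forall\mathbf{x}.[\varphi(\mathbf{x})\to\exists\mathbf{y}.[\bigvee_{i=1}^n\psi_i(\mathbf{x},\mathbf{y})]]$ with the body $\varphi$ and the $\psi_i$ conjunctions of distinct atoms ($n\ge 0$; for $n=0$ the head is the empty disjunction, i.e. $\bot$). Rules are safe (all universally quantified variables in the head occur in the body), and w.l.o.g. the truth symbol $\top$ does not occur in rule heads and $\bot$ does not occur in rule bodies. Universal quantifiers are usually omitted. A TBox is a finite set of rules; TBoxes mentioning equality are extended with its standard axiomatisation. A fact is a function-free ground atom; an ABox is a finite set of facts; a $\Sigma$-ABox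 is an ABox over the predicates of $\Sigma$. Standing assumptions: $\mathcal{T}$ contains no constants and rules in $\mathcal{T}$ do not share existentially quantified variables. In $A(\mathbf{x})\to B(\mathbf{x})$, $\mathbf{x}$ is a tuple of (w.l.o.g. pairwise distinct) universally quantified variables. Datalog. A rule is datalog if its head has at most one atom and all variables are universally quantified; a datalog program $\mathcal{P}$ is a set of datalog rules. A fact $\gamma$ is a consequence of a datalog rule $\bigwedge_{i=1}^n\gamma_i'\to\delta$ and facts $\gamma_1,\dots,\gamma_n$ if $\gamma=\delta\sigma$ with $\sigma$ a most general unifier of $\gamma_i,\gamma_i'$ for each $1\le i\le n$. A proof of $\gamma$ in $\mathcal{P}\cup\mathcal{A}$ ($\mathcal{A}$ an ABox) is a pair $(T,\lambda)$ with $T$ a tree and $\lambda$ mapping nodes of $T$ to facts and edges of $T$ to rules of $\mathcal{P}$, such that for each node $v$: (1) $\lambda(v)=\gamma$ if $v$ is the root; (2) $\lambda(v)\in\mathcal{A}$ if $v$ is a leaf; (3) if $v$ has children $w_1,\dots,w_n$, then all edges from $v$ to the $w_i$ are labelled by the same rule $r$ and $\lambda(v)$ is a consequence of $r$ and $\lambda(w_1),\dots,\lambda(w_n)$. The support of $\gamma$ is the set of rules occurring in some proof of $\gamma$ in $\mathcal{P}\cup\mathcal{A}$. Module settings. A module setting for $\mathcal{T}$ and $\Sigma$ is a tuple $\chi=\langle\theta,\mathcal{A}_0,\mathcal{A}_r\rangle$ with $\theta$ a substitution from the existentially quantified variables of $\mathcal{T}$ to constants, $\mathcal{A}_0$ a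 $\Sigma$-ABox, $\mathcal{A}_r$ a $\mathrm{sig}(\mathcal{T})$-ABox, and such that no constant in $\chi$ occurs in $\mathcal{T}$. The program $\mathcal{P}^\chi$ is the smallest datalog program containing, for each rule $\varphi(\mathbf{x})\to\exists\mathbf{y}.[\bigvee_{i=1}^n\psi_i(\mathbf{x},\mathbf{y})]$ in $\mathcal{T}$, the following corresponding datalog rules: $\varphi\to\bot$ if $n=0$, and $\varphi\to\gamma\theta$ for each $1\le i\le n$ and each atom $\gamma$ in $\psi_i$. The support of $\chi$ is the set of rules of $\mathcal{P}^\chi$ that support a fact from $\mathcal{A}_r$ in $\mathcal{P}^\chi\cup\mathcal{A}_0$. The module $\mathcal{M}^\chi$ is the set of rules in $\mathcal{T}$ that have a corresponding datalog rule in the support of $\chi$. The setting $\chi_{\mathsf i}$. Let $c_y$ be a fresh constant for each existentially quantified variable $y$ in $\mathcal{T}$, and let $c_A^1,\dots,c_A^n$ be also fresh constants for each $A\in\Sigma$ of arity $n$. Then $\theta^{\mathsf i}=\{y\mapsto c_y\mid y\text{ existentially quantified in }\mathcal{T}\}$; $\mathcal{A}_0^{\mathsf i}=\{A(c_A^1,\dots,c_A^n)\mid A\ n\text{-ary predicate in }\Sigma\}$; $\mathcal{A}_r^{\mathsf i}=\{B(c_A^1,\dots,c_A^n)\mid A\ne B\ n\text{-ary predicates in }\Sigma\}$.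
   Formalization: ⊥ is put in A_r whenever Σ has another predicate, of any arity, and A(x)→⊥ is also covered: with ⊥ only nullary the claim fails for T={A(x)→⊥, D(x)→B(x)}, Σ={A,B,⊥}. The fact ⊤ may be a leaf of any proof, so that rules with body ⊤ can fire. *)

theory Defs
  imports Main
begin

section \<open>Syntax\<close>

text \<open>Truth and falsehood are nullary symbols. Falsehood counts as a predicate and belongs to every
  signature; truth is a logical symbol and belongs to none. Equality is an ordinary predicate
  symbol: its axiomatisation, when needed, is part of the TBox.\<close>

datatype 'p pred = Top | Bot | Sym 'p

datatype ('v, 'c) trm = Var 'v | Const 'c

datatype ('p, 'v, 'c) atom = Atom (pred_of: "'p pred") (args: "('v, 'c) trm list")

text \<open>\<open>Rule \<phi> Y [\<psi>\<^sub>1, \<dots>, \<psi>\<^sub>n]\<close> is \<open>\<forall>x. (\<And>\<phi> \<longrightarrow> (\<exists>y. \<Or>i. \<And>\<psi>\<^sub>i))\<close>, where \<open>Y\<close> holds the variables of the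
  tuple \<open>y\<close> and all other variables are universally quantified.\<close>

datatype ('p, 'v, 'c) rule =
  Rule (body: "('p, 'v, 'c) atom list") (ex: "'v set") (heads: "('p, 'v, 'c) atom list list")

fun trm_vars :: "('v, 'c) trm \<Rightarrow> 'v set" where
  "trm_vars (Var x) = {x}"
| "trm_vars (Const c) = {}"

fun trm_consts :: "('v, 'c) trm \<Rightarrow> 'c set" where
  "trm_consts (Var x) = {}"
| "trm_consts (Const c) = {c}"

definition atom_vars :: "('p, 'v, 'c) atom \<Rightarrow> 'v set" where
  "atom_vars a = (\<Union>t\<in>set (args a). trm_vars t)"

definition atom_consts :: "('p, 'v, 'c) atom \<Rightarrow> 'c set" where
  "atom_consts a = (\<Union>t\<in>set (args a). trm_consts t)"

definition head_atoms :: "('p, 'v, 'c) rule \<Rightarrow> ('p, 'v, 'c) atom set" where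
  "head_atoms r = (\<Union>\<psi>\<in>set (heads r). set \<psi>)"

definition rule_atoms :: "('p, 'v, 'c) rule \<Rightarrow> ('p, 'v, 'c) atom set" where
  "rule_atoms r = set (body r) \<union> head_atoms r"

definition body_vars :: "('p, 'v, 'c) rule \<Rightarrow> 'v set" where
  "body_vars r = (\<Union>a\<in>set (body r). atom_vars a)"

definition head_vars :: "('p, 'v, 'c) rule \<Rightarrow> 'v set" where
  "head_vars r = (\<Union>a\<in>head_atoms r. atom_vars a)"

definition exvars :: "('p, 'v, 'c) rule set \<Rightarrow> 'v set" where
  "exvars T = (\<Union>r\<in>T. ex r)"

definition consts_of :: "('p, 'v, 'c) rule set \<Rightarrow> 'c set" where
  "consts_of T = (\<Union>r\<in>T. \<Union>a\<in>rule_atoms r. atom_consts a)"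

definition sig :: "('p, 'v, 'c) rule set \<Rightarrow> 'p pred set" where
  "sig T = insert Bot ((\<Union>r\<in>T. pred_of ` rule_atoms r) - {Top})"

fun arity :: "('p \<Rightarrow> nat) \<Rightarrow> 'p pred \<Rightarrow> nat" where
  "arity ar Top = 0"
| "arity ar Bot = 0"
| "arity ar (Sym p) = ar p"

definition wf_atom :: "('p \<Rightarrow> nat) \<Rightarrow> ('p, 'v, 'c) atom \<Rightarrow> bool" where
  "wf_atom ar a \<longleftrightarrow> length (args a) = arity ar (pred_of a)"

text \<open>An otherwise empty body is written as the single atom \<open>\<top>\<close>; the last conjunct is safety.\<close>

definition wf_rule :: "('p \<Rightarrow> nat) \<Rightarrow> ('p, 'v, 'c) rule \<Rightarrow> bool" where
  "wf_rule ar r \<longleftrightarrow>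
     (\<forall>a\<in>rule_atoms r. wf_atom ar a) \<and>
     body r \<noteq> [] \<and> distinct (body r) \<and>
     (\<forall>\<psi>\<in>set (heads r). \<psi> \<noteq> [] \<and> distinct \<psi>) \<and>
     Bot \<notin> pred_of ` set (body r) \<and>
     Top \<notin> pred_of ` head_atoms r \<and>
     finite (ex r) \<and> ex r \<inter> body_vars r = {} \<and>
     head_vars r \<subseteq> body_vars r \<union> ex r"

definition tbox :: "('p \<Rightarrow> nat) \<Rightarrow> ('p, 'v, 'c) rule set \<Rightarrow> bool" where
  "tbox ar T \<longleftrightarrow>
     finite T \<and> (\<forall>r\<in>T. wf_rule ar r) \<and>
     consts_of T = {} \<and>
     (\<forall>r\<in>T. \<forall>s\<in>T. r \<noteq> s \<longrightarrow> ex r \<inter> ex s = {})"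

definition fact :: "('p \<Rightarrow> nat) \<Rightarrow> ('p, 'v, 'c) atom \<Rightarrow> bool" where
  "fact ar a \<longleftrightarrow> wf_atom ar a \<and> atom_vars a = {}"

definition abox :: "('p \<Rightarrow> nat) \<Rightarrow> 'p pred set \<Rightarrow> ('p, 'v, 'c) atom set \<Rightarrow> bool" where
  "abox ar \<Sigma> A \<longleftrightarrow> finite A \<and> (\<forall>a\<in>A. fact ar a \<and> pred_of a \<in> \<Sigma>)"

text \<open>A tuple \<open>x\<close> of length \<open>arity ar A\<close> can be an argument of \<open>B\<close>. Falsehood is allowed for tuples of
  every length, \<open>\<bottom>(x)\<close> being just \<open>\<bottom>\<close>, so that \<open>A(x) \<longrightarrow> \<bottom>\<close> is one of the implications considered.\<close>

definition applicable :: "('p \<Rightarrow> nat) \<Rightarrow> 'p pred \<Rightarrow> 'p pred \<Rightarrow> bool" where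
  "applicable ar A B \<longleftrightarrow> B = Bot \<or> arity ar B = arity ar A"

definition atm :: "'p pred \<Rightarrow> ('v, 'c) trm list \<Rightarrow> ('p, 'v, 'c) atom" where
  "atm B ts = Atom B (if B = Bot then [] else ts)"

definition implication :: "'p pred \<Rightarrow> 'p pred \<Rightarrow> 'v list \<Rightarrow> ('p, 'v, 'c) rule" where
  "implication A B xs = Rule [atm A (map Var xs)] {} [[atm B (map Var xs)]]"

section \<open>Semantics\<close>

record ('p, 'c, 'u) interp =
  dmn :: "'u set"
  con :: "'c \<Rightarrow> 'u"
  rel :: "'p \<Rightarrow> 'u list set"

definition interpretation_for :: "('p \<Rightarrow> nat) \<Rightarrow> ('p, 'c, 'u) interp \<Rightarrow> bool" where
  "interpretation_for ar I \<longleftrightarrow>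
     dmn I \<noteq> {} \<and> range (con I) \<subseteq> dmn I \<and>
     (\<forall>p. rel I p \<subseteq> {ds. length ds = ar p \<and> set ds \<subseteq> dmn I})"

fun trm_val :: "('p, 'c, 'u) interp \<Rightarrow> ('v \<Rightarrow> 'u) \<Rightarrow> ('v, 'c) trm \<Rightarrow> 'u" where
  "trm_val I \<sigma> (Var x) = \<sigma> x"
| "trm_val I \<sigma> (Const c) = con I c"

fun pred_holds :: "('p, 'c, 'u) interp \<Rightarrow> 'p pred \<Rightarrow> 'u list \<Rightarrow> bool" where
  "pred_holds I Top ds \<longleftrightarrow> True"
| "pred_holds I Bot ds \<longleftrightarrow> False"
| "pred_holds I (Sym p) ds \<longleftrightarrow> ds \<in> rel I p"

definition atom_holds :: "('p, 'c, 'u) interp \<Rightarrow> ('v \<Rightarrow> 'u) \<Rightarrow> ('p, 'v, 'c) atom \<Rightarrow> bool" where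
  "atom_holds I \<sigma> a \<longleftrightarrow> pred_holds I (pred_of a) (map (trm_val I \<sigma>) (args a))"

definition rule_holds :: "('p, 'c, 'u) interp \<Rightarrow> ('p, 'v, 'c) rule \<Rightarrow> bool" where
  "rule_holds I r \<longleftrightarrow>
     (\<forall>\<sigma>. range \<sigma> \<subseteq> dmn I \<longrightarrow> (\<forall>a\<in>set (body r). atom_holds I \<sigma> a) \<longrightarrow>
        (\<exists>\<tau>. range \<tau> \<subseteq> dmn I \<and> (\<forall>x. x \<notin> ex r \<longrightarrow> \<tau> x = \<sigma> x) \<and>
           (\<exists>\<psi>\<in>set (heads r). \<forall>a\<in>set \<psi>. atom_holds I \<tau> a)))"

text \<open>The domains range over all nonempty subsets of the type \<open>'u\<close>. For infinite \<open>'u\<close> and finite sets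
  of rules this is first-order entailment, by the downward Loewenheim-Skolem theorem.\<close>

definition entails ::
  "'u itself \<Rightarrow> ('p \<Rightarrow> nat) \<Rightarrow> ('p, 'v, 'c) rule set \<Rightarrow> ('p, 'v, 'c) rule \<Rightarrow> bool" where
  "entails U ar F \<phi> \<longleftrightarrow>
     (\<forall>I :: ('p, 'c, 'u) interp.
        interpretation_for ar I \<longrightarrow> (\<forall>r\<in>F. rule_holds I r) \<longrightarrow> rule_holds I \<phi>)"

definition implication_inseparable ::
  "'u itself \<Rightarrow> ('p \<Rightarrow> nat) \<Rightarrow> 'p pred set \<Rightarrow>
     ('p, 'v, 'c) rule set \<Rightarrow> ('p, 'v, 'c) rule set \<Rightarrow> bool" where
  "implication_inseparable U ar \<Sigma> F G \<longleftrightarrow>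
     (\<forall>A\<in>\<Sigma>. \<forall>B\<in>\<Sigma>. \<forall>xs. applicable ar A B \<longrightarrow> distinct xs \<longrightarrow> length xs = arity ar A \<longrightarrow>
        (entails U ar F (implication A B xs) \<longleftrightarrow> entails U ar G (implication A B xs)))"

section \<open>Datalog\<close>

text \<open>Datalog rules; an empty head is represented by \<open>\<bottom>\<close>.\<close>

datatype ('p, 'v, 'c) drule =
  DRule (dbody: "('p, 'v, 'c) atom list") (dhead: "('p, 'v, 'c) atom")

fun subst_trm :: "('v \<Rightarrow> ('v, 'c) trm) \<Rightarrow> ('v, 'c) trm \<Rightarrow> ('v, 'c) trm" where
  "subst_trm \<sigma> (Var x) = \<sigma> x"
| "subst_trm \<sigma> (Const c) = Const c"

definition subst_atom ::
  "('v \<Rightarrow> ('v, 'c) trm) \<Rightarrow> ('p, 'v, 'c) atom \<Rightarrow> ('p, 'v, 'c) atom" where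
  "subst_atom \<sigma> a = Atom (pred_of a) (map (subst_trm \<sigma>) (args a))"

definition unifier ::
  "('v \<Rightarrow> ('v, 'c) trm) \<Rightarrow> ('p, 'v, 'c) atom list \<Rightarrow> ('p, 'v, 'c) atom list \<Rightarrow> bool" where
  "unifier \<sigma> as bs \<longleftrightarrow> map (subst_atom \<sigma>) as = map (subst_atom \<sigma>) bs"

definition most_general_unifier ::
  "('v \<Rightarrow> ('v, 'c) trm) \<Rightarrow> ('p, 'v, 'c) atom list \<Rightarrow> ('p, 'v, 'c) atom list \<Rightarrow> bool" where
  "most_general_unifier \<sigma> as bs \<longleftrightarrow>
     unifier \<sigma> as bs \<and>
     (\<forall>\<tau>. unifier \<tau> as bs \<longrightarrow> (\<exists>\<rho>. \<forall>x. \<tau> x = subst_trm \<rho> (\<sigma> x)))"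

definition consequence ::
  "('p, 'v, 'c) drule \<Rightarrow> ('p, 'v, 'c) atom list \<Rightarrow> ('p, 'v, 'c) atom \<Rightarrow> bool" where
  "consequence r \<gamma>s \<gamma> \<longleftrightarrow>
     atom_vars \<gamma> = {} \<and>
     (\<exists>\<sigma>. most_general_unifier \<sigma> \<gamma>s (dbody r) \<and> \<gamma> = subst_atom \<sigma> (dhead r))"

text \<open>All edges from an inner node to its children carry the same rule, which is stored at the node.\<close>

datatype ('p, 'v, 'c) proof_tree =
  Leaf "('p, 'v, 'c) atom"
| Node "('p, 'v, 'c) atom" "('p, 'v, 'c) drule" "('p, 'v, 'c) proof_tree list"

fun root :: "('p, 'v, 'c) proof_tree \<Rightarrow> ('p, 'v, 'c) atom" where
  "root (Leaf \<gamma>) = \<gamma>"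
| "root (Node \<gamma> r ts) = \<gamma>"

fun rules_in :: "('p, 'v, 'c) proof_tree \<Rightarrow> ('p, 'v, 'c) drule set" where
  "rules_in (Leaf \<gamma>) = {}"
| "rules_in (Node \<gamma> r ts) = insert r (\<Union>t\<in>set ts. rules_in t)"

text \<open>The fact \<open>\<top>\<close> is available as a leaf in every ABox.\<close>

fun is_proof ::
  "('p, 'v, 'c) drule set \<Rightarrow> ('p, 'v, 'c) atom set \<Rightarrow> ('p, 'v, 'c) proof_tree \<Rightarrow> bool" where
  "is_proof P A (Leaf \<gamma>) \<longleftrightarrow> \<gamma> \<in> A \<or> \<gamma> = Atom Top []"
| "is_proof P A (Node \<gamma> r ts) \<longleftrightarrow>
     ts \<noteq> [] \<and> r \<in> P \<and> consequence r (map root ts) \<gamma> \<and> (\<forall>t\<in>set ts. is_proof P A t)"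

definition fact_support ::
  "('p, 'v, 'c) drule set \<Rightarrow> ('p, 'v, 'c) atom set \<Rightarrow> ('p, 'v, 'c) atom \<Rightarrow> ('p, 'v, 'c) drule set" where
  "fact_support P A \<gamma> = {r. \<exists>t. is_proof P A t \<and> root t = \<gamma> \<and> r \<in> rules_in t}"

section \<open>Module settings and modules\<close>

record ('p, 'v, 'c) setting =
  theta :: "'v \<Rightarrow> 'c"
  initial :: "('p, 'v, 'c) atom set"
  relevant :: "('p, 'v, 'c) atom set"

text \<open>The substitution is a total function of which only the values on \<open>exvars T\<close> matter.\<close>

definition setting_consts ::
  "('p, 'v, 'c) rule set \<Rightarrow> ('p, 'v, 'c) setting \<Rightarrow> 'c set" where
  "setting_consts T \<chi> =
     theta \<chi> ` exvars T \<union> (\<Union>a\<in>initial \<chi> \<union> relevant \<chi>. atom_consts a)"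

definition module_setting ::
  "('p \<Rightarrow> nat) \<Rightarrow> ('p, 'v, 'c) rule set \<Rightarrow> 'p pred set \<Rightarrow> ('p, 'v, 'c) setting \<Rightarrow> bool" where
  "module_setting ar T \<Sigma> \<chi> \<longleftrightarrow>
     abox ar \<Sigma> (initial \<chi>) \<and> abox ar (sig T) (relevant \<chi>) \<and>
     setting_consts T \<chi> \<inter> consts_of T = {}"

definition theta_subst :: "('p, 'v, 'c) setting \<Rightarrow> ('p, 'v, 'c) rule \<Rightarrow> 'v \<Rightarrow> ('v, 'c) trm" where
  "theta_subst \<chi> r x = (if x \<in> ex r then Const (theta \<chi> x) else Var x)"

definition datalog_rules ::
  "('p, 'v, 'c) setting \<Rightarrow> ('p, 'v, 'c) rule \<Rightarrow> ('p, 'v, 'c) drule set" where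
  "datalog_rules \<chi> r =
     (if heads r = [] then {DRule (body r) (Atom Bot [])}
      else (\<lambda>\<gamma>. DRule (body r) (subst_atom (theta_subst \<chi> r) \<gamma>)) ` head_atoms r)"

definition program ::
  "('p, 'v, 'c) rule set \<Rightarrow> ('p, 'v, 'c) setting \<Rightarrow> ('p, 'v, 'c) drule set" where
  "program T \<chi> = (\<Union>r\<in>T. datalog_rules \<chi> r)"

definition support ::
  "('p, 'v, 'c) rule set \<Rightarrow> ('p, 'v, 'c) setting \<Rightarrow> ('p, 'v, 'c) drule set" where
  "support T \<chi> = (\<Union>\<gamma>\<in>relevant \<chi>. fact_support (program T \<chi>) (initial \<chi>) \<gamma>)"

definition module_of ::
  "('p, 'v, 'c) rule set \<Rightarrow> ('p, 'v, 'c) setting \<Rightarrow> ('p, 'v, 'c) rule set" where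
  "module_of T \<chi> = {r \<in> T. datalog_rules \<chi> r \<inter> support T \<chi> \<noteq> {}}"

section \<open>The setting for implication inseparability\<close>

text \<open>\<open>cE y\<close> stands for \<open>c\<^sub>y\<close> and \<open>cP A i\<close> for the constant of \<open>A\<close> at argument position \<open>i\<close>, counted
  from \<open>0\<close>.\<close>

definition fresh_constants ::
  "('p \<Rightarrow> nat) \<Rightarrow> ('p, 'v, 'c) rule set \<Rightarrow> 'p pred set \<Rightarrow>
     ('v \<Rightarrow> 'c) \<Rightarrow> ('p pred \<Rightarrow> nat \<Rightarrow> 'c) \<Rightarrow> bool" where
  "fresh_constants ar T \<Sigma> cE cP \<longleftrightarrow>
     (let E = cE ` exvars T;
          K = {(A, i). A \<in> \<Sigma> \<and> i < arity ar A};
          Q = (\<lambda>(A, i). cP A i) ` K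
      in inj_on cE (exvars T) \<and> inj_on (\<lambda>(A, i). cP A i) K \<and>
         E \<inter> Q = {} \<and> (E \<union> Q) \<inter> consts_of T = {})"

definition generic_tuple ::
  "('p \<Rightarrow> nat) \<Rightarrow> ('p pred \<Rightarrow> nat \<Rightarrow> 'c) \<Rightarrow> 'p pred \<Rightarrow> ('v, 'c) trm list" where
  "generic_tuple ar cP A = map (\<lambda>i. Const (cP A i)) [0..<arity ar A]"

definition chi_i ::
  "('p \<Rightarrow> nat) \<Rightarrow> 'p pred set \<Rightarrow> ('v \<Rightarrow> 'c) \<Rightarrow> ('p pred \<Rightarrow> nat \<Rightarrow> 'c) \<Rightarrow> ('p, 'v, 'c) setting" where
  "chi_i ar \<Sigma> cE cP =
     \<lparr> theta = cE,
       initial = {atm A (generic_tuple ar cP A) | A. A \<in> \<Sigma>},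
       relevant = {atm B (generic_tuple ar cP A) | A B.
                     A \<in> \<Sigma> \<and> B \<in> \<Sigma> \<and> A \<noteq> B \<and> applicable ar A B} \<rparr>"

lemma finite_sig: "finite T \<Longrightarrow> finite (sig T)"
  by (auto simp: sig_def rule_atoms_def head_atoms_def)

lemma fact_generic:
  "applicable ar A B \<Longrightarrow> fact ar (atm B (generic_tuple ar cP A))"
  by (auto simp: fact_def wf_atom_def atm_def generic_tuple_def atom_vars_def applicable_def)

lemma module_setting_chi_i:
  fixes T :: "('p, 'v, 'c) rule set"
  assumes "tbox ar T" and "\<Sigma> \<subseteq> sig T"
  shows "module_setting ar T \<Sigma> (chi_i ar \<Sigma> cE cP)"
proof -
  have fin: "finite \<Sigma>"
    using assms finite_sig finite_subset unfolding tbox_def by blast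
  let ?f = "\<lambda>(A, B). atm B (generic_tuple ar cP A) :: ('p, 'v, 'c) atom"
  have "{atm B (generic_tuple ar cP A) :: ('p, 'v, 'c) atom | A B.
          A \<in> \<Sigma> \<and> B \<in> \<Sigma> \<and> A \<noteq> B \<and> applicable ar A B} \<subseteq> ?f ` (\<Sigma> \<times> \<Sigma>)"
    by auto
  then have "finite {atm B (generic_tuple ar cP A) :: ('p, 'v, 'c) atom | A B.
          A \<in> \<Sigma> \<and> B \<in> \<Sigma> \<and> A \<noteq> B \<and> applicable ar A B}"
    using fin by (meson finite_SigmaI finite_imageI finite_subset)
  moreover have "applicable ar A A" for A by (simp add: applicable_def)
  moreover have "consts_of T = {}" using assms by (simp add: tbox_def)
  ultimately show ?thesis
    using fin assms(2)
    by (auto simp: module_setting_def abox_def chi_i_def intro: fact_generic)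
       (auto simp: atm_def)
qed

end

theory Submission
  imports Defs
begin

text \<open>Let \<open>I\<close> be a model of the module refuting \<open>A(x) \<longrightarrow> B(x)\<close>. Pair the elements of \<open>I\<close> with constants
  as labels, and let a predicate hold of a tuple of pairs iff the datalog fact about the labels is
  derivable and, in case this fact occurs in some proof of a relevant fact, the predicate also holds
  in \<open>I\<close> of the underlying elements. If a rule of \<open>T\<close> applies in this structure and one of its datalog
  heads occurs in a proof of a relevant fact, then so do its body facts and the rule belongs to the
  module, so that \<open>I\<close> provides a disjunct. Otherwise any disjunct will do, witnessed by elements with
  the labels \<open>c\<^sub>y\<close>. Since \<open>B(c\<^sub>A)\<close> is relevant, the implication remains refuted.\<close>

section \<open>Ground instances of datalog rules\<close>

text \<open>With \<open>l\<close> the labels of a valuation in the labelled model, this is the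
  datalog fact that decides the truth of the atom there.\<close>

definition ground :: "('v \<Rightarrow> 'c) \<Rightarrow> ('p, 'v, 'c) atom \<Rightarrow> ('p, 'v, 'c) atom" where
  "ground l = subst_atom (\<lambda>x. Const (l x))"

lemma pred_of_ground [simp]: "pred_of (ground l a) = pred_of a"
  by (simp add: ground_def subst_atom_def)

lemma subst_trm_eq_iff:
  "subst_trm \<sigma> t = subst_trm \<tau> t \<longleftrightarrow> (\<forall>x\<in>trm_vars t. \<sigma> x = \<tau> x)"
  by (cases t) auto

lemma subst_trm_id: "trm_vars t = {} \<Longrightarrow> subst_trm \<sigma> t = t"
  by (cases t) auto

lemma subst_atom_eq_iff:
  "subst_atom \<sigma> a = subst_atom \<tau> a \<longleftrightarrow> (\<forall>x\<in>atom_vars a. \<sigma> x = \<tau> x)"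
  by (auto simp: subst_atom_def atom_vars_def subst_trm_eq_iff)

lemma subst_atom_id: "atom_vars a = {} \<Longrightarrow> subst_atom \<sigma> a = a"
  by (cases a) (auto simp: subst_atom_def atom_vars_def subst_trm_id intro!: map_idI)

lemma atom_vars_ground [simp]: "atom_vars (ground l a) = {}"
proof -
  have "trm_vars (subst_trm (\<lambda>x. Const (l x)) t) = {}" for t
    by (cases t) auto
  then show ?thesis
    by (auto simp: ground_def subst_atom_def atom_vars_def)
qed

text \<open>Translates between datalog heads, where existential variables have already become
  constants, and heads of the original rule under a valuation that labels these variables by those
  constants.\<close>

lemma ground_theta_subst:
  fixes a :: "('p, 'v, 'c) atom"
  shows "ground l (subst_atom (theta_subst \<chi> r) a) = ground (\<lambda>x. if x \<in> ex r then theta \<chi> x else l x) a"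
proof -
  have "subst_trm (\<lambda>x. Const (l x)) (subst_trm (theta_subst \<chi> r) t)
      = subst_trm (\<lambda>x. Const (if x \<in> ex r then theta \<chi> x else l x)) t" for t :: "('v, 'c) trm"
    by (cases t) (auto simp: theta_subst_def)
  then show ?thesis by (simp add: ground_def subst_atom_def)
qed

text \<open>The facts are variable-free, so unification is matching: the unifiers are exactly the
  substitutions that agree with \<open>l\<close> on the body variables. Safety makes the head ground
  as well.\<close>

lemma consequence_ground:
  fixes d :: "('p, 'v, 'c) drule"
  assumes safe: "atom_vars (dhead d) \<subseteq> (\<Union>a\<in>set (dbody d). atom_vars a)"
  shows "consequence d (map (ground l) (dbody d)) (ground l (dhead d))"
proof -
  let ?V = "\<Union>a\<in>set (dbody d). atom_vars a"
  \<comment> \<open>Leaving all other variables fixed keeps \<sigma> most general: every unifier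
    \<tau> satisfies \<tau> = \<tau> after \<sigma>, hence is its own factor.\<close>
  define \<sigma> where "\<sigma> x = (if x \<in> ?V then Const (l x) else Var x)" for x
  have \<sigma>_ground: "subst_atom \<sigma> a = ground l a" if "atom_vars a \<subseteq> ?V" for a :: "('p, 'v, 'c) atom"
    unfolding ground_def subst_atom_eq_iff using that by (auto simp: \<sigma>_def)
  have unifier_iff: "unifier \<tau> (map (ground l) (dbody d)) (dbody d) \<longleftrightarrow> (\<forall>x\<in>?V. \<tau> x = Const (l x))"
    for \<tau> :: "'v \<Rightarrow> ('v, 'c) trm"
  proof -
    have "unifier \<tau> (map (ground l) (dbody d)) (dbody d) \<longleftrightarrow>
        (\<forall>a\<in>set (dbody d). ground l a = subst_atom \<tau> a)"
      by (simp add: unifier_def subst_atom_id)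
    also have "\<dots> \<longleftrightarrow> (\<forall>x\<in>?V. \<tau> x = Const (l x))"
      by (force simp: ground_def subst_atom_eq_iff)
    finally show ?thesis .
  qed
  have "most_general_unifier \<sigma> (map (ground l) (dbody d)) (dbody d)"
    unfolding most_general_unifier_def unifier_iff
  proof (intro conjI allI impI)
    show "\<forall>x\<in>?V. \<sigma> x = Const (l x)" by (simp add: \<sigma>_def)
    fix \<tau> :: "'v \<Rightarrow> ('v, 'c) trm" assume "\<forall>x\<in>?V. \<tau> x = Const (l x)"
    then have "\<forall>x. \<tau> x = subst_trm \<tau> (\<sigma> x)" by (auto simp: \<sigma>_def)
    then show "\<exists>\<rho>. \<forall>x. \<tau> x = subst_trm \<rho> (\<sigma> x)" by (rule exI[of _ \<tau>])
  qed
  then show ?thesis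
    using \<sigma>_ground[OF safe] by (auto simp: consequence_def)
qed

lemma datalog_rules_dbody: "d \<in> datalog_rules \<chi> r \<Longrightarrow> dbody d = body r"
  by (auto simp: datalog_rules_def split: if_splits)

text \<open>Safety of a rule allows existential variables in the head besides body variables, and
  \<open>theta\<close> turns the former into constants.\<close>

lemma datalog_rules_safe:
  assumes wf: "wf_rule ar r" and d: "d \<in> datalog_rules \<chi> r"
  shows "atom_vars (dhead d) \<subseteq> (\<Union>a\<in>set (dbody d). atom_vars a)"
proof (cases "heads r = []")
  case True
  then show ?thesis using d by (auto simp: datalog_rules_def atom_vars_def)
next
  case False
  then obtain \<gamma> where \<gamma>: "\<gamma> \<in> head_atoms r" "dhead d = subst_atom (theta_subst \<chi> r) \<gamma>"
    using d by (auto simp: datalog_rules_def)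
  have "trm_vars (subst_trm (theta_subst \<chi> r) t) \<subseteq> trm_vars t - ex r" for t
    by (cases t) (auto simp: theta_subst_def)
  then have "atom_vars (dhead d) \<subseteq> atom_vars \<gamma> - ex r"
    unfolding \<gamma>(2) by (fastforce simp: atom_vars_def subst_atom_def)
  also have "\<dots> \<subseteq> body_vars r"
    using wf \<gamma>(1) by (auto simp: wf_rule_def head_vars_def)
  finally show ?thesis
    using datalog_rules_dbody[OF d] by (simp add: body_vars_def)
qed

section \<open>Derivable and useful facts\<close>

definition derivable ::
  "('p, 'v, 'c) drule set \<Rightarrow> ('p, 'v, 'c) atom set \<Rightarrow> ('p, 'v, 'c) atom \<Rightarrow> bool" where
  "derivable P A \<gamma> \<longleftrightarrow> (\<exists>t. is_proof P A t \<and> root t = \<gamma>)"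

fun facts_in :: "('p, 'v, 'c) proof_tree \<Rightarrow> ('p, 'v, 'c) atom set" where
  "facts_in (Leaf \<gamma>) = {\<gamma>}"
| "facts_in (Node \<gamma> r ts) = insert \<gamma> (\<Union>t\<in>set ts. facts_in t)"

text \<open>The support records rules, whereas the labelled model has to decide for single facts
  whether they can still contribute to a relevant one.\<close>

definition useful ::
  "('p, 'v, 'c) rule set \<Rightarrow> ('p, 'v, 'c) setting \<Rightarrow> ('p, 'v, 'c) atom \<Rightarrow> bool" where
  "useful T \<chi> \<gamma> \<longleftrightarrow>
     (\<exists>t. is_proof (program T \<chi>) (initial \<chi>) t \<and> root t \<in> relevant \<chi> \<and> \<gamma> \<in> facts_in t)"

lemma root_in_facts_in: "root t \<in> facts_in t"
  by (cases t) auto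

text \<open>A subproof may be exchanged for any other proof of the same fact. So each way of
  deriving a useful fact contributes to a relevant one, not only the way taken in the given
  proof.\<close>

lemma graft_proof:
  assumes "is_proof P A t" and "is_proof P A s" and "root s \<in> facts_in t"
  obtains t' where "is_proof P A t'" "root t' = root t"
    "rules_in s \<subseteq> rules_in t'" "facts_in s \<subseteq> facts_in t'"
proof -
  have "\<exists>t'. is_proof P A t' \<and> root t' = root t \<and> rules_in s \<subseteq> rules_in t' \<and> facts_in s \<subseteq> facts_in t'"
    using assms(1,3)
  proof (induction t)
    case (Leaf \<gamma>)
    then show ?case using assms(2) by auto
  next
    case (Node \<gamma> r ts)
    show ?case
    proof (cases "root s = \<gamma>")
      case True
      then show ?thesis using assms(2) by auto
    next
      case False
      then obtain u where u: "u \<in> set ts" "root s \<in> facts_in u"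
        using Node.prems by auto
      obtain us vs where ts: "ts = us @ u # vs"
        using u(1) by (auto dest: split_list)
      obtain u' where u': "is_proof P A u'" "root u' = root u"
          "rules_in s \<subseteq> rules_in u'" "facts_in s \<subseteq> facts_in u'"
        using Node.IH[OF u(1) _ u(2)] Node.prems(1) u(1) by auto
      \<comment> \<open>The new child has the same root as the old one, so the rule application at
        the node stays correct.\<close>
      show ?thesis
        using Node.prems(1) u' by (intro exI[of _ "Node \<gamma> r (us @ u' # vs)"]) (auto simp: ts)
    qed
  qed
  then show thesis using that by blast
qed

lemma derivable_step:
  assumes wf: "wf_rule ar r" and r: "r \<in> T" and d: "d \<in> datalog_rules \<chi> r"
    and body: "\<And>a. a \<in> set (body r) \<Longrightarrow> derivable (program T \<chi>) A (ground l a)"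
  obtains t where "is_proof (program T \<chi>) A t" "root t = ground l (dhead d)"
    "d \<in> rules_in t" "ground l ` set (body r) \<subseteq> facts_in t"
proof -
  obtain f where f: "\<And>a. a \<in> set (body r) \<Longrightarrow>
      is_proof (program T \<chi>) A (f a) \<and> root (f a) = ground l a"
    using body unfolding derivable_def by metis
  let ?t = "Node (ground l (dhead d)) d (map f (body r))"
  have roots: "map root (map f (body r)) = map (ground l) (dbody d)"
    using f datalog_rules_dbody[OF d] by simp
  \<comment> \<open>Inner nodes need a child, and rule bodies are nonempty by
    \<open>wf_rule\<close>.\<close>
  have "is_proof (program T \<chi>) A ?t"
    using wf r d f consequence_ground[OF datalog_rules_safe[OF wf d], of l]
    unfolding is_proof.simps roots by (auto simp: wf_rule_def program_def)
  moreover have "ground l ` set (body r) \<subseteq> facts_in ?t"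
  proof
    fix \<gamma> assume "\<gamma> \<in> ground l ` set (body r)"
    then obtain a where a: "a \<in> set (body r)" "\<gamma> = root (f a)" using f by auto
    then show "\<gamma> \<in> facts_in ?t" using root_in_facts_in[of "f a"] by auto
  qed
  ultimately show thesis by (intro that[of ?t]) simp_all
qed

text \<open>Put \<open>d\<close> on top of proofs of the body facts and graft the result into a
  relevant proof containing the head: then \<open>d\<close> is in the support, and the body facts
  occur in a relevant proof.\<close>

lemma useful_step:
  assumes wf: "wf_rule ar r" and r: "r \<in> T" and d: "d \<in> datalog_rules \<chi> r"
    and body: "\<And>a. a \<in> set (body r) \<Longrightarrow> derivable (program T \<chi>) (initial \<chi>) (ground l a)"
    and useful: "useful T \<chi> (ground l (dhead d))"
  shows "r \<in> module_of T \<chi>" and "a \<in> set (body r) \<Longrightarrow> useful T \<chi> (ground l a)"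
proof -
  obtain s where s: "is_proof (program T \<chi>) (initial \<chi>) s" "root s = ground l (dhead d)"
      "d \<in> rules_in s" "ground l ` set (body r) \<subseteq> facts_in s"
    using derivable_step[OF wf r d body] by blast
  obtain t where t: "is_proof (program T \<chi>) (initial \<chi>) t" "root t \<in> relevant \<chi>"
      "ground l (dhead d) \<in> facts_in t"
    using useful by (auto simp: useful_def)
  obtain t' where t': "is_proof (program T \<chi>) (initial \<chi>) t'" "root t' = root t"
      "rules_in s \<subseteq> rules_in t'" "facts_in s \<subseteq> facts_in t'"
    using graft_proof[OF t(1) s(1)] s(2) t(3) by auto
  have "d \<in> support T \<chi>"
    unfolding support_def fact_support_def using s(3) t(2) t' by auto
  then show "r \<in> module_of T \<chi>"
    using r d by (auto simp: module_of_def)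
  show "useful T \<chi> (ground l a)" if "a \<in> set (body r)"
    unfolding useful_def using that s(4) t(2) t' by (metis image_subset_iff subsetD)
qed

lemma relevant_useful:
  "derivable (program T \<chi>) (initial \<chi>) \<gamma> \<Longrightarrow> \<gamma> \<in> relevant \<chi> \<Longrightarrow> useful T \<chi> \<gamma>"
  unfolding derivable_def useful_def using root_in_facts_in by blast

section \<open>The labelled model\<close>

text \<open>An element \<open>u\<close> encodes the pair of \<open>val u\<close>, in the domain of \<open>I\<close>, and the label \<open>lab u\<close>.
  The interpretation of the constants is irrelevant, as TBoxes contain none.\<close>

definition labelled_model ::
  "('p \<Rightarrow> nat) \<Rightarrow> ('p, 'v, 'c) rule set \<Rightarrow> ('p, 'v, 'c) setting \<Rightarrow>
     ('u \<Rightarrow> 'u) \<Rightarrow> ('u \<Rightarrow> 'c) \<Rightarrow> ('p, 'c, 'u) interp \<Rightarrow> ('p, 'c, 'u) interp" where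
  "labelled_model ar T \<chi> val lab I =
     \<lparr> dmn = {u. val u \<in> dmn I},
       con = (\<lambda>_. SOME u. val u \<in> dmn I),
       rel = (\<lambda>p. {us. length us = ar p \<and> val ` set us \<subseteq> dmn I \<and>
          (let \<gamma> = Atom (Sym p) (map (\<lambda>u. Const (lab u)) us) :: ('p, 'v, 'c) atom
           in derivable (program T \<chi>) (initial \<chi>) \<gamma> \<and>
              (useful T \<chi> \<gamma> \<longrightarrow> map val us \<in> rel I p))}) \<rparr>"

lemma dmn_labelled_model: "dmn (labelled_model ar T \<chi> val lab I) = {u. val u \<in> dmn I}"
  by (simp add: labelled_model_def)

lemma interpretation_labelled_model:
  assumes "interpretation_for ar I" and "surj val"
  shows "interpretation_for ar (labelled_model ar T \<chi> val lab I)"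
proof -
  have ex: "\<exists>u. val u \<in> dmn I"
    using assms unfolding interpretation_for_def by (metis ex_in_conv surjD)
  then have "val (SOME u. val u \<in> dmn I) \<in> dmn I" by (rule someI_ex)
  with ex show ?thesis
    by (auto simp: interpretation_for_def labelled_model_def)
qed

text \<open>Without constants every argument is a variable, so its label and its underlying element
  both come from \<sigma>.\<close>

lemma atom_holds_labelled_model:
  fixes T :: "('p, 'v, 'c) rule set"
  assumes wf: "wf_atom ar a" and no_consts: "atom_consts a = {}" and p: "pred_of a = Sym p"
    and \<sigma>: "range \<sigma> \<subseteq> dmn (labelled_model ar T \<chi> val lab I)"
  shows "atom_holds (labelled_model ar T \<chi> val lab I) \<sigma> a \<longleftrightarrow>
    derivable (program T \<chi>) (initial \<chi>) (ground (\<lambda>x. lab (\<sigma> x)) a) \<and>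
    (useful T \<chi> (ground (\<lambda>x. lab (\<sigma> x)) a) \<longrightarrow> atom_holds I (\<lambda>x. val (\<sigma> x)) a)"
proof -
  let ?J = "labelled_model ar T \<chi> val lab I"
  have "\<exists>x. t = Var x" if "t \<in> set (args a)" for t
    using no_consts that by (cases t) (auto simp: atom_consts_def)
  then have "\<exists>xs. args a = map Var xs"
    unfolding ex_map_conv by blast
  then obtain xs where xs: "args a = map Var xs" ..
  have a: "a = Atom (Sym p) (map Var xs)"
    using xs p by (cases a) simp
  have ground: "ground (\<lambda>x. lab (\<sigma> x)) a = Atom (Sym p) (map (\<lambda>u. Const (lab u)) (map \<sigma> xs))"
    by (simp add: a ground_def subst_atom_def)
  have len: "length xs = ar p" using wf by (simp add: wf_atom_def a)
  have "val ` set (map \<sigma> xs) \<subseteq> dmn I" using \<sigma> by (auto simp: dmn_labelled_model)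
  moreover have "atom_holds ?J \<sigma> a \<longleftrightarrow> map \<sigma> xs \<in> rel ?J p"
    by (simp add: atom_holds_def a comp_def)
  moreover have "atom_holds I (\<lambda>x. val (\<sigma> x)) a \<longleftrightarrow> map val (map \<sigma> xs) \<in> rel I p"
    by (simp add: atom_holds_def a comp_def)
  ultimately show ?thesis
    unfolding ground by (simp add: labelled_model_def len Let_def)
qed

text \<open>Relevance of falsehood makes it useful as soon as it is derivable, so rules deriving it
  fall under the control of \<open>I\<close>. The assumption \<open>labels\<close> supplies
  witnesses with any underlying element and the required label.\<close>

lemma rule_holds_labelled_model:
  fixes T :: "('p, 'v, 'c) rule set" and I :: "('p, 'c, 'u) interp"
  assumes T: "tbox ar T" and r: "r \<in> T"
    and bot: "Atom Bot [] \<in> relevant \<chi>"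
    and I: "\<And>r. r \<in> module_of T \<chi> \<Longrightarrow> rule_holds I r"
    and labels: "\<And>e y. y \<in> exvars T \<Longrightarrow> \<exists>u. val u = e \<and> lab u = theta \<chi> y"
  shows "rule_holds (labelled_model ar T \<chi> val lab I) r"
  unfolding rule_holds_def
proof (intro allI impI)
  let ?J = "labelled_model ar T \<chi> val lab I"
  let ?der = "derivable (program T \<chi>) (initial \<chi>)"
  fix \<sigma> assume \<sigma>: "range \<sigma> \<subseteq> dmn ?J" and body: "\<forall>a\<in>set (body r). atom_holds ?J \<sigma> a"
  have wf: "wf_rule ar r" using T r by (simp add: tbox_def)
  have wf_a: "wf_atom ar a" and no_consts: "atom_consts a = {}" if "a \<in> rule_atoms r" for a
    using T r wf that by (auto simp: tbox_def wf_rule_def consts_of_def)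
  define l where "l x = lab (\<sigma> x)" for x
  \<comment> \<open>The labels of the valuation to be built: existential variables receive their
    constants.\<close>
  define l' where "l' x = (if x \<in> ex r then theta \<chi> x else l x)" for x
  have body': "?der (ground l a) \<and> (useful T \<chi> (ground l a) \<longrightarrow> atom_holds I (\<lambda>x. val (\<sigma> x)) a)"
    if a: "a \<in> set (body r)" for a
  proof (cases "pred_of a")
    case Top
    have "ground l a = Atom Top []"
      using wf_a[of a] a Top by (cases a) (auto simp: rule_atoms_def wf_atom_def ground_def subst_atom_def)
    then have "?der (ground l a)"
      unfolding derivable_def by (intro exI[of _ "Leaf (Atom Top [])"]) simp
    then show ?thesis using Top by (simp add: atom_holds_def)
  next
    case Bot
    then have "Bot \<in> pred_of ` set (body r)" using a by (metis imageI)
    then show ?thesis using wf by (simp add: wf_rule_def)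
  next
    case (Sym p)
    then show ?thesis
      using atom_holds_labelled_model[OF wf_a no_consts Sym \<sigma>] a body
      by (auto simp: rule_atoms_def l_def [abs_def])
  qed
  have step: "?der (ground l (dhead d))" if "d \<in> datalog_rules \<chi> r" for d
    using derivable_step[OF wf r that] body' unfolding derivable_def by metis
  have head_rule: "\<exists>d\<in>datalog_rules \<chi> r. ground l (dhead d) = ground l' a"
    if "a \<in> head_atoms r" for a
  proof -
    have "heads r \<noteq> []" using that by (auto simp: head_atoms_def)
    then have "DRule (body r) (subst_atom (theta_subst \<chi> r) a) \<in> datalog_rules \<chi> r"
      using that by (auto simp: datalog_rules_def)
    then show ?thesis by (rule rev_bexI) (simp add: ground_theta_subst l'_def [abs_def])
  qed
  have head_der: "?der (ground l' a)" if "a \<in> head_atoms r" for a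
    using head_rule[OF that] step by metis
  \<comment> \<open>A disjunct has to hold in \<open>I\<close> only where the labelled model
    consults \<open>I\<close>, namely for its useful atoms.\<close>
  have "\<exists>\<tau>. range \<tau> \<subseteq> dmn I \<and> (\<forall>x. x \<notin> ex r \<longrightarrow> \<tau> x = val (\<sigma> x)) \<and>
      (\<exists>\<psi>\<in>set (heads r). \<forall>a\<in>set \<psi>. useful T \<chi> (ground l' a) \<longrightarrow> atom_holds I \<tau> a)"
  proof (cases "\<exists>d\<in>datalog_rules \<chi> r. useful T \<chi> (ground l (dhead d))")
    case True
    then obtain d where d: "d \<in> datalog_rules \<chi> r" "useful T \<chi> (ground l (dhead d))" ..
    have "rule_holds I r"
      using I useful_step(1)[OF wf r d(1) _ d(2)] body' by blast
    moreover have "range (\<lambda>x. val (\<sigma> x)) \<subseteq> dmn I"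
      using \<sigma> by (auto simp: dmn_labelled_model)
    moreover have "\<forall>a\<in>set (body r). atom_holds I (\<lambda>x. val (\<sigma> x)) a"
      using useful_step(2)[OF wf r d(1) _ d(2)] body' by blast
    ultimately have "\<exists>\<tau>. range \<tau> \<subseteq> dmn I \<and> (\<forall>x. x \<notin> ex r \<longrightarrow> \<tau> x = val (\<sigma> x)) \<and>
        (\<exists>\<psi>\<in>set (heads r). \<forall>a\<in>set \<psi>. atom_holds I \<tau> a)"
      by (rule rule_holds_def[THEN iffD1, THEN spec, THEN mp, THEN mp])
    then show ?thesis by metis
  next
    case False
    \<comment> \<open>A rule with empty head would derive falsehood, which is relevant and hence
      useful, against the case assumption.\<close>
    have "heads r \<noteq> []"
    proof
      assume "heads r = []"
      then have d: "DRule (body r) (Atom Bot []) \<in> datalog_rules \<chi> r"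
        by (simp add: datalog_rules_def)
      moreover have "ground l (Atom Bot []) = (Atom Bot [] :: ('p, 'v, 'c) atom)"
        by (simp add: ground_def subst_atom_def)
      ultimately show False
        using False step[OF d] relevant_useful[OF _ bot] by force
    qed
    then have "hd (heads r) \<in> set (heads r)" by simp
    moreover have "\<not> useful T \<chi> (ground l' a)" if "a \<in> head_atoms r" for a
      using head_rule[OF that] False by metis
    ultimately have "\<exists>\<psi>\<in>set (heads r). \<forall>a\<in>set \<psi>. \<not> useful T \<chi> (ground l' a)"
      by (intro bexI[of _ "hd (heads r)"]) (auto simp: head_atoms_def)
    moreover have "range (\<lambda>x. val (\<sigma> x)) \<subseteq> dmn I"
      using \<sigma> by (auto simp: dmn_labelled_model)
    ultimately show ?thesis by (intro exI[of _ "\<lambda>x. val (\<sigma> x)"]) auto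
  qed
  then obtain \<tau> \<psi> where \<tau>: "range \<tau> \<subseteq> dmn I" "\<And>x. x \<notin> ex r \<Longrightarrow> \<tau> x = val (\<sigma> x)"
      and \<psi>: "\<psi> \<in> set (heads r)"
      and \<psi>_holds: "\<And>a. a \<in> set \<psi> \<Longrightarrow> useful T \<chi> (ground l' a) \<Longrightarrow> atom_holds I \<tau> a"
    by blast
  have "\<exists>u. val u = \<tau> x \<and> lab u = theta \<chi> x" if "x \<in> ex r" for x
    using labels r that by (auto simp: exvars_def)
  then obtain w where w: "\<And>x. x \<in> ex r \<Longrightarrow> val (w x) = \<tau> x \<and> lab (w x) = theta \<chi> x"
    by metis
  \<comment> \<open>Underlying elements come from \<tau>, labels from \<open>l'\<close>.\<close>
  define \<sigma>' where "\<sigma>' x = (if x \<in> ex r then w x else \<sigma> x)" for x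
  have val_\<sigma>': "(\<lambda>x. val (\<sigma>' x)) = \<tau>" and lab_\<sigma>': "(\<lambda>x. lab (\<sigma>' x)) = l'"
    using w \<tau>(2) by (auto simp: \<sigma>'_def l'_def l_def)
  have \<sigma>': "range \<sigma>' \<subseteq> dmn ?J"
  proof -
    have "val (\<sigma>' x) \<in> dmn I" for x
      using \<tau>(1) val_\<sigma>' by (metis range_subsetD)
    then show ?thesis by (auto simp: dmn_labelled_model)
  qed
  have "atom_holds ?J \<sigma>' a" if a: "a \<in> set \<psi>" for a
  proof -
    have a': "a \<in> head_atoms r" "a \<in> rule_atoms r"
      using a \<psi> by (auto simp: head_atoms_def rule_atoms_def)
    show ?thesis
    proof (cases "pred_of a")
      case Top
      then show ?thesis by (simp add: atom_holds_def)
    next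
      case Bot
      \<comment> \<open>The chosen disjunct cannot contain falsehood: being derivable it would be
        useful, so \<open>I\<close> would have to satisfy it.\<close>
      then have "ground l' a = Atom Bot []"
        using wf_a[OF a'(2)] by (cases a) (auto simp: wf_atom_def ground_def subst_atom_def)
      then have "useful T \<chi> (ground l' a)"
        using relevant_useful[OF _ bot] head_der[OF a'(1)] by simp
      then have "atom_holds I \<tau> a" by (rule \<psi>_holds[OF a])
      then show ?thesis using Bot by (simp add: atom_holds_def)
    next
      case (Sym p)
      show ?thesis
        unfolding atom_holds_labelled_model[OF wf_a[OF a'(2)] no_consts[OF a'(2)] Sym \<sigma>']
          val_\<sigma>' lab_\<sigma>'
        using head_der[OF a'(1)] \<psi>_holds[OF a] by blast
    qed
  qed
  then show "\<exists>\<tau>. range \<tau> \<subseteq> dmn ?J \<and> (\<forall>x. x \<notin> ex r \<longrightarrow> \<tau> x = \<sigma> x) \<and>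
      (\<exists>\<psi>\<in>set (heads r). \<forall>a\<in>set \<psi>. atom_holds ?J \<tau> a)"
    using \<sigma>' \<psi> by (intro exI[of _ \<sigma>']) (auto simp: \<sigma>'_def)
qed

text \<open>Entailment ranges over domains inside the fixed type \<open>'u\<close>, so the pairs
  must be coded there. An infinite type is in bijection with its square, and finitely many labels
  embed into it whatever the size of \<open>'c\<close>.\<close>

lemma infinite_labelling:
  fixes F :: "'c set"
  assumes inf: "infinite (UNIV :: 'u set)" and F: "finite F"
  obtains val :: "'u \<Rightarrow> 'u" and lab :: "'u \<Rightarrow> 'c"
  where "\<And>e c. \<exists>u. val u = e \<and> (c \<in> F \<longrightarrow> lab u = c)"
proof -
  obtain s :: "'u \<times> 'u \<Rightarrow> 'u" where s: "bij s"
    using card_of_Times_same_infinite[OF inf] unfolding card_of_ordIso[symmetric] by auto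
  obtain g :: "'c \<Rightarrow> 'u" where g: "inj_on g F"
  proof -
    obtain h :: "nat \<Rightarrow> 'u" where h: "inj h"
      using infinite_countable_subset[OF inf] by blast
    obtain i :: "'c \<Rightarrow> nat" where i: "inj_on i F"
      using finite_imp_inj_to_nat_seg[OF F] by blast
    have "inj_on (h \<circ> i) F"
      using i h by (meson comp_inj_on inj_on_subset subset_UNIV)
    then show thesis by (rule that)
  qed
  show thesis
  proof
    fix e :: 'u and c :: 'c
    \<comment> \<open>Decoding by \<open>inv s\<close> gives the element as first component and the
      code of the label as second.\<close>
    show "\<exists>u. (fst \<circ> inv s) u = e \<and> (c \<in> F \<longrightarrow> (inv_into F g \<circ> snd \<circ> inv s) u = c)"
      using s g by (intro exI[of _ "s (e, g c)"]) (simp add: bij_is_inj)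
  qed
qed

section \<open>Inseparability\<close>

lemma rule_holds_implication:
  "rule_holds I (implication A B xs) \<longleftrightarrow>
     (\<forall>\<sigma>. range \<sigma> \<subseteq> dmn I \<longrightarrow> atom_holds I \<sigma> (atm A (map Var xs)) \<longrightarrow>
        atom_holds I \<sigma> (atm B (map Var xs)))"
proof -
  have "(\<forall>x. \<tau> x = \<sigma> x) \<longleftrightarrow> \<tau> = \<sigma>" for \<tau> \<sigma> :: "'d \<Rightarrow> 'c" by auto
  then show ?thesis by (auto simp: rule_holds_def implication_def)
qed

lemma entails_module:
  fixes T :: "('p, 'v, 'c) rule set"
  assumes inf: "infinite (UNIV :: 'u set)" and T: "tbox ar T"
    and bot: "Bot \<in> \<Sigma>" and \<Sigma>: "\<Sigma> \<subseteq> sig T"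
    and A: "A \<in> \<Sigma>" and B: "B \<in> \<Sigma>" and appl: "applicable ar A B"
    and xs: "distinct xs" "length xs = arity ar A"
    and ent: "entails TYPE('u) ar T (implication A B xs)"
  shows "entails TYPE('u) ar (module_of T (chi_i ar \<Sigma> cE cP)) (implication A B xs)"
proof (rule ccontr)
  define \<chi> :: "('p, 'v, 'c) setting" where "\<chi> = chi_i ar \<Sigma> cE cP"
  assume "\<not> ?thesis"
  then obtain I :: "('p, 'c, 'u) interp" and \<sigma> where
      I: "interpretation_for ar I" "\<And>r. r \<in> module_of T \<chi> \<Longrightarrow> rule_holds I r"
    and \<sigma>: "range \<sigma> \<subseteq> dmn I"
    and holds_A: "atom_holds I \<sigma> (atm A (map Var xs))"
    and fails_B: "\<not> atom_holds I \<sigma> (atm B (map Var xs))"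
    unfolding entails_def rule_holds_implication \<chi>_def by blast
  have no_Top: "Top \<notin> \<Sigma>" using \<Sigma> by (auto simp: sig_def)
  obtain p where p: "A = Sym p"
    using holds_A A no_Top by (cases A) (auto simp: atom_holds_def atm_def)
  \<comment> \<open>Relevant facts are formed for distinct predicates only; a refuted implication is
    no tautology.\<close>
  have AB: "A \<noteq> B" using holds_A fails_B by auto
  \<comment> \<open>The labels needed: one for each existential variable, and those of the generic
    tuple of \<open>A\<close>.\<close>
  define F where "F = cE ` exvars T \<union> cP A ` {..<arity ar A}"
  have "finite (exvars T)"
    using T by (auto simp: tbox_def exvars_def wf_rule_def)
  then have "finite F" by (simp add: F_def)
  then obtain val :: "'u \<Rightarrow> 'u" and lab :: "'u \<Rightarrow> 'c" where
      labels: "\<And>e c. \<exists>u. val u = e \<and> (c \<in> F \<longrightarrow> lab u = c)"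
    using infinite_labelling[OF inf] by blast
  let ?J = "labelled_model ar T \<chi> val lab I"
  \<comment> \<open>This relevant fact stems from the implication from \<open>A\<close> to
    falsehood.\<close>
  have bot_rel: "Atom Bot [] \<in> relevant \<chi>"
    using A bot by (auto simp: \<chi>_def chi_i_def atm_def applicable_def p intro!: exI[of _ A])
  have "surj val"
    unfolding surj_def using labels by metis
  with I(1) have "interpretation_for ar ?J"
    by (rule interpretation_labelled_model)
  moreover have "\<forall>r\<in>T. rule_holds ?J r"
  proof
    fix r assume r: "r \<in> T"
    show "rule_holds ?J r"
    proof (rule rule_holds_labelled_model[OF T r bot_rel I(2)])
      fix e y assume "y \<in> exvars T"
      then have "theta \<chi> y \<in> F" by (simp add: \<chi>_def chi_i_def F_def)
      then show "\<exists>u. val u = e \<and> lab u = theta \<chi> y" using labels by blast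
    qed
  qed
  ultimately have J: "rule_holds ?J (implication A B xs)"
    using ent unfolding entails_def by blast
  \<comment> \<open>As \<open>xs\<close> is distinct, a variable determines its position, and the
    i-th one is labelled by the i-th constant of \<open>A\<close>.\<close>
  define l where "l x = cP A (inv_into {..<length xs} ((!) xs) x)" for x
  have l_nth: "l (xs ! i) = cP A i" if "i < length xs" for i
    using that xs(1) by (simp add: l_def inj_on_nth)
  \<comment> \<open>The guard remains because variables outside \<open>xs\<close> may be assigned
    labels outside \<open>F\<close>.\<close>
  have "\<forall>x. \<exists>u. val u = \<sigma> x \<and> (l x \<in> F \<longrightarrow> lab u = l x)"
    using labels by blast
  then obtain \<sigma>' where "\<forall>x. val (\<sigma>' x) = \<sigma> x \<and> (l x \<in> F \<longrightarrow> lab (\<sigma>' x) = l x)"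
    unfolding choice_iff ..
  then have \<sigma>': "val (\<sigma>' x) = \<sigma> x" "l x \<in> F \<Longrightarrow> lab (\<sigma>' x) = l x" for x
    by simp_all
  have \<sigma>'_dmn: "range \<sigma>' \<subseteq> dmn ?J"
    using \<sigma> \<sigma>'(1) by (auto simp: dmn_labelled_model)
  have lab_xs: "map (\<lambda>x. Const (lab (\<sigma>' x))) xs = (generic_tuple ar cP A :: ('v, 'c) trm list)"
  proof (rule nth_equalityI)
    fix i assume "i < length (map (\<lambda>x. Const (lab (\<sigma>' x)) :: ('v, 'c) trm) xs)"
    then have i: "i < length xs" by simp
    then have "l (xs ! i) \<in> F" using xs(2) by (simp add: l_nth F_def)
    then show "map (\<lambda>x. Const (lab (\<sigma>' x)) :: ('v, 'c) trm) xs ! i = generic_tuple ar cP A ! i"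
      using i xs(2) by (simp add: generic_tuple_def \<sigma>'(2) l_nth)
  qed (simp add: generic_tuple_def xs(2))
  have ground_xs: "ground (\<lambda>x. lab (\<sigma>' x)) (atm C (map Var xs)) =
      (atm C (generic_tuple ar cP A) :: ('p, 'v, 'c) atom)" for C
    by (simp add: ground_def subst_atom_def atm_def lab_xs[symmetric])
  have no_consts: "atom_consts (atm C (map Var xs) :: ('p, 'v, 'c) atom) = {}" for C
    by (auto simp: atom_consts_def atm_def)
  have "atom_holds ?J \<sigma>' (atm A (map Var xs))"
  proof (subst atom_holds_labelled_model[OF _ no_consts _ \<sigma>'_dmn])
    show "wf_atom ar (atm A (map Var xs) :: ('p, 'v, 'c) atom)"
      using xs(2) by (simp add: wf_atom_def atm_def p)
    show "pred_of (atm A (map Var xs) :: ('p, 'v, 'c) atom) = Sym p"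
      by (simp add: atm_def p)
    \<comment> \<open>\<open>A\<close> holds in the labelled model on both counts: its fact is
      initial, and \<open>I\<close> satisfies it under \<sigma>.\<close>
    have "atm A (generic_tuple ar cP A) \<in> initial \<chi>"
      using A by (auto simp: \<chi>_def chi_i_def)
    then have "derivable (program T \<chi>) (initial \<chi>) (atm A (generic_tuple ar cP A))"
      unfolding derivable_def by (intro exI[of _ "Leaf (atm A (generic_tuple ar cP A))"]) simp
    then show "derivable (program T \<chi>) (initial \<chi>) (ground (\<lambda>x. lab (\<sigma>' x)) (atm A (map Var xs))) \<and>
      (useful T \<chi> (ground (\<lambda>x. lab (\<sigma>' x)) (atm A (map Var xs))) \<longrightarrow>
        atom_holds I (\<lambda>x. val (\<sigma>' x)) (atm A (map Var xs)))"
      using holds_A by (simp add: ground_xs \<sigma>'(1))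
  qed
  then have holds_B: "atom_holds ?J \<sigma>' (atm B (map Var xs))"
    using J \<sigma>'_dmn unfolding rule_holds_implication by blast
  then obtain q where q: "B = Sym q"
    using B no_Top by (cases B) (auto simp: atom_holds_def atm_def)
  have "wf_atom ar (atm B (map Var xs) :: ('p, 'v, 'c) atom)"
    using xs(2) appl by (auto simp: wf_atom_def atm_def q applicable_def)
  moreover have "pred_of (atm B (map Var xs) :: ('p, 'v, 'c) atom) = Sym q"
    by (simp add: atm_def q)
  ultimately have "derivable (program T \<chi>) (initial \<chi>) (atm B (generic_tuple ar cP A))"
      "useful T \<chi> (atm B (generic_tuple ar cP A)) \<Longrightarrow> atom_holds I \<sigma> (atm B (map Var xs))"
    using holds_B atom_holds_labelled_model[OF _ no_consts _ \<sigma>'_dmn]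
    by (auto simp: ground_xs \<sigma>'(1))
  \<comment> \<open>Derivable and relevant, the fact is useful, so \<open>B\<close> would hold in
    \<open>I\<close> under \<sigma>.\<close>
  moreover have "atm B (generic_tuple ar cP A) \<in> relevant \<chi>"
    using A B AB appl by (auto simp: \<chi>_def chi_i_def)
  ultimately show False
    using fails_B relevant_useful by blast
qed

theorem theorem3:
  fixes ar :: "'p \<Rightarrow> nat"
    and T :: "('p, 'v, 'c) rule set"
    and \<Sigma> :: "'p pred set"
    and cE :: "'v \<Rightarrow> 'c"
    and cP :: "'p pred \<Rightarrow> nat \<Rightarrow> 'c"
  assumes "infinite (UNIV :: 'u set)"
    and "tbox ar T"
    and "Bot \<in> \<Sigma>" and "\<Sigma> \<subseteq> sig T"
    and "fresh_constants ar T \<Sigma> cE cP"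
  shows "implication_inseparable TYPE('u) ar \<Sigma> (module_of T (chi_i ar \<Sigma> cE cP)) T"
proof -
  \<comment> \<open>The direction from the module to \<open>T\<close> is monotonicity of
    entailment.\<close>
  have "module_of T (chi_i ar \<Sigma> cE cP) \<subseteq> T"
    by (auto simp: module_of_def)
  then have "entails TYPE('u) ar T \<phi>" if "entails TYPE('u) ar (module_of T (chi_i ar \<Sigma> cE cP)) \<phi>" for \<phi>
    using that unfolding entails_def by blast
  then show ?thesis
    using entails_module[OF assms(1-4)] unfolding implication_inseparable_def by blast
qed

end
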